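(* Let $F$ be a forest. If $F$ contains $P_2$ but no $P_3$ as an induced subgraph, then $F$ is $\omega$-unfrozen and $\chi$-unfrozen. If $F$ contains $P_3$ as an induced subgraph, then $F$ is neither $\omega$-unfrozen nor $\chi$-unfrozen.
   Context: Graphs are finite, undirected, simple, without loops. A forest is a graph without cycles, i.e. a disjoint union of trees (connected acyclic graphs). $P_n$ is the path with $n$ vertices. $\omega(G)$ is the size of a maximum clique and $\chi(G)$ the chromatic number. A nonedge of $G$ is a pair $e=\{u,v\}$ of distinct vertices with $e\notin E(G)$; $G+e$ is $G$ with $e$ added as an edge. For a parameter $\xi$, $G$ is $\xi$-unfrozen if $\xi(G+e)=\xi(G)$ for every nonedge $e$ of $G$. *)

theory Defs
  imports Main "HOL-Library.Ramsey"
begin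

record 'a ugraph =
  verts :: "'a set"
  edges :: "'a set set"

definition fin_simple_graph :: "'a ugraph \<Rightarrow> bool" where
  "fin_simple_graph G \<longleftrightarrow> finite (verts G) \<and> edges G \<subseteq> {e. e \<subseteq> verts G \<and> card e = 2}"

text \<open>A cycle is given by the list of its vertices, without repeating the first one at the end.\<close>

definition is_cycle :: "'a ugraph \<Rightarrow> 'a list \<Rightarrow> bool" where
  "is_cycle G vs \<longleftrightarrow> length vs \<ge> 3 \<and> distinct vs \<and> set vs \<subseteq> verts G \<and>
     (\<forall>i < length vs. {vs ! i, vs ! (Suc i mod length vs)} \<in> edges G)"

definition forest :: "'a ugraph \<Rightarrow> bool" where
  "forest G \<longleftrightarrow> fin_simple_graph G \<and> (\<nexists>vs. is_cycle G vs)"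

definition path_graph :: "nat \<Rightarrow> nat ugraph" where
  "path_graph n = \<lparr>verts = {0..<n}, edges = {{i, Suc i} | i. Suc i < n}\<rparr>"

definition induced_subgraph :: "'a ugraph \<Rightarrow> 'a set \<Rightarrow> 'a ugraph" where
  "induced_subgraph G S = \<lparr>verts = S, edges = {e \<in> edges G. e \<subseteq> S}\<rparr>"

definition graph_iso :: "'a ugraph \<Rightarrow> 'b ugraph \<Rightarrow> bool" where
  "graph_iso G H \<longleftrightarrow> (\<exists>f. bij_betw f (verts G) (verts H) \<and>
     (\<forall>u \<in> verts G. \<forall>v \<in> verts G. {u, v} \<in> edges G \<longleftrightarrow> {f u, f v} \<in> edges H))"

definition contains_induced :: "'a ugraph \<Rightarrow> 'b ugraph \<Rightarrow> bool" where
  "contains_induced G H \<longleftrightarrow> (\<exists>S \<subseteq> verts G. graph_iso (induced_subgraph G S) H)"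

definition clique_number :: "'a ugraph \<Rightarrow> nat" where
  "clique_number G = Max {card K | K. K \<subseteq> verts G \<and> clique K (edges G)}"

definition proper_coloring :: "'a ugraph \<Rightarrow> nat \<Rightarrow> ('a \<Rightarrow> nat) \<Rightarrow> bool" where
  "proper_coloring G k c \<longleftrightarrow> c ` verts G \<subseteq> {..<k} \<and>
     (\<forall>u \<in> verts G. \<forall>v \<in> verts G. {u, v} \<in> edges G \<longrightarrow> c u \<noteq> c v)"

definition chromatic_number :: "'a ugraph \<Rightarrow> nat" where
  "chromatic_number G = (LEAST k. \<exists>c. proper_coloring G k c)"

definition nonedges :: "'a ugraph \<Rightarrow> 'a set set" where
  "nonedges G = {{u, v} | u v. u \<in> verts G \<and> v \<in> verts G \<and> u \<noteq> v \<and> {u, v} \<notin> edges G}"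

definition add_edge :: "'a ugraph \<Rightarrow> 'a set \<Rightarrow> 'a ugraph" where
  "add_edge G e = \<lparr>verts = verts G, edges = insert e (edges G)\<rparr>"

definition unfrozen :: "('a ugraph \<Rightarrow> nat) \<Rightarrow> 'a ugraph \<Rightarrow> bool" where
  "unfrozen \<xi> G \<longleftrightarrow> (\<forall>e \<in> nonedges G. \<xi> (add_edge G e) = \<xi> G)"

end

theory Submission
  imports Defs
begin

text \<open>
  A forest is triangle-free and, as the endpoints of its longest paths are leaves, 2-colourable.
  If it contains an induced path on the vertices a, b, c, then adding the edge ac creates a
  triangle and raises both parameters. Otherwise its edges form a matching, and a matching plus
  one further edge is still triangle-free and 2-colourable: if the colouring is wrong on the new
  edge, swap the colours on the component of one of its endpoints.
\<close>

section \<open>Simple graphs and their induced paths\<close>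

lemma fin_simple_graphD:
  assumes "fin_simple_graph G" "{u, v} \<in> edges G"
  shows "u \<in> verts G" "v \<in> verts G" "u \<noteq> v"
  using assms unfolding fin_simple_graph_def by (auto simp: card_insert_if split: if_splits)

lemma fin_simple_graph_add_edge:
  assumes "fin_simple_graph G" "e \<in> nonedges G"
  shows "fin_simple_graph (add_edge G e)"
  using assms unfolding fin_simple_graph_def nonedges_def add_edge_def by auto

lemma contains_induced_path_2D:
  assumes "contains_induced G (path_graph 2)"
  obtains u v where "u \<in> verts G" "v \<in> verts G" "{u, v} \<in> edges G"
proof -
  obtain S f where S: "S \<subseteq> verts G" and f: "bij_betw f S {0..<2::nat}"
    and iso: "\<And>u v. u \<in> S \<Longrightarrow> v \<in> S \<Longrightarrow>
      {u, v} \<in> edges G \<longleftrightarrow> {f u, f v} \<in> edges (path_graph 2)"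
    using assms unfolding contains_induced_def graph_iso_def induced_subgraph_def path_graph_def
    by auto
  have "0 \<in> f ` S" "1 \<in> f ` S" using f by (auto simp: bij_betw_def)
  then obtain u v where uv: "u \<in> S" "v \<in> S" "f u = 0" "f v = 1" by (metis imageE)
  have "{f u, f v} \<in> edges (path_graph 2)"
    using uv by (auto simp: path_graph_def)
  with uv S iso that show thesis by blast
qed

text \<open>This trades the isomorphism for a condition on three edges, the form used in both halves
  of the theorem. The middle vertex differs from the ends because there are no loops, so only
  \<open>a \<noteq> c\<close> has to be demanded.\<close>

lemma contains_induced_path_3_iff:
  assumes "fin_simple_graph G"
  shows "contains_induced G (path_graph 3) \<longleftrightarrow>
    (\<exists>a b c. a \<noteq> c \<and> {a, b} \<in> edges G \<and> {b, c} \<in> edges G \<and> {a, c} \<notin> edges G)"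
    (is "_ \<longleftrightarrow> ?R")
proof
  assume "contains_induced G (path_graph 3)"
  then obtain S f where S: "S \<subseteq> verts G" and f: "bij_betw f S {0..<3::nat}"
    and iso: "\<And>u v. u \<in> S \<Longrightarrow> v \<in> S \<Longrightarrow>
      {u, v} \<in> edges G \<longleftrightarrow> {f u, f v} \<in> edges (path_graph 3)"
    unfolding contains_induced_def graph_iso_def induced_subgraph_def path_graph_def
    by auto
  have "0 \<in> f ` S" "1 \<in> f ` S" "2 \<in> f ` S" using f by (auto simp: bij_betw_def)
  then obtain a b c where abc: "a \<in> S" "b \<in> S" "c \<in> S" "f a = 0" "f b = 1" "f c = 2"
    by (metis imageE)
  have "{f a, f b} \<in> edges (path_graph 3)" "{f b, f c} \<in> edges (path_graph 3)"
    "{f a, f c} \<notin> edges (path_graph 3)" "a \<noteq> c"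
    using abc by (auto simp: path_graph_def doubleton_eq_iff numeral_2_eq_2)
  with abc iso show ?R by blast
next
  assume ?R
  then obtain a b c where E: "a \<noteq> c" "{a, b} \<in> edges G" "{b, c} \<in> edges G" "{a, c} \<notin> edges G"
    by blast
  note D = fin_simple_graphD[OF assms E(2)] fin_simple_graphD[OF assms E(3)]
  \<comment> \<open>The isomorphism condition also ranges over pairs with \<open>u = v\<close>,
    where \<open>{u, v}\<close> collapses to a singleton.\<close>
  have nl: "{x} \<notin> edges G" for x
    using fin_simple_graphD(3)[OF assms, of x x] by auto
  define f where "f = (\<lambda>x. if x = a then 0 else if x = b then 1 else (2::nat))"
  have "bij_betw f {a, b, c} {0..<3}"
    using D E(1) unfolding bij_betw_def inj_on_def f_def by (auto simp: image_def)
  moreover have "\<forall>u\<in>{a, b, c}. \<forall>v\<in>{a, b, c}.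
      ({u, v} \<in> edges G) = (\<exists>i. {f u, f v} = {i, Suc i} \<and> Suc i < 3)"
    using D E nl by (auto simp: f_def doubleton_eq_iff insert_commute numeral_2_eq_2)
  ultimately show "contains_induced G (path_graph 3)"
    unfolding contains_induced_def graph_iso_def induced_subgraph_def path_graph_def
    using D by (intro exI[of _ "{a, b, c}"]) auto
qed

section \<open>Bounds on the clique number\<close>

lemma clique_number_ge:
  assumes "finite (verts G)" "K \<subseteq> verts G" "clique K (edges G)"
  shows "card K \<le> clique_number G"
  unfolding clique_number_def using assms by (intro Max_ge) auto

lemma clique_number_le:
  assumes "finite (verts G)" "\<And>K. K \<subseteq> verts G \<Longrightarrow> clique K (edges G) \<Longrightarrow> card K \<le> k"
  shows "clique_number G \<le> k"
proof -
  \<comment> \<open>The empty clique ensures that \<open>Max\<close> is applied to a nonempty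
    set.\<close>
  have "{card K | K. K \<subseteq> verts G \<and> clique K (edges G)} \<noteq> {}"
    by (auto simp: clique_def intro: exI[of _ "{}"])
  then show ?thesis unfolding clique_number_def using assms by (intro Max.boundedI) auto
qed

lemma clique_number_ge_2:
  assumes "fin_simple_graph G" "{u, v} \<in> edges G"
  shows "2 \<le> clique_number G"
  using clique_number_ge[of G "{u, v}"] assms fin_simple_graphD[OF assms]
  by (auto simp: clique_def insert_commute fin_simple_graph_def)

lemma clique_number_ge_3:
  assumes "fin_simple_graph G" "{a, b} \<in> edges G" "{b, c} \<in> edges G" "{a, c} \<in> edges G"
  shows "3 \<le> clique_number G"
  using clique_number_ge[of G "{a, b, c}"] assms fin_simple_graphD[OF assms(1,2)]
    fin_simple_graphD[OF assms(1,3)] fin_simple_graphD[OF assms(1,4)]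
  by (auto simp: clique_def insert_commute fin_simple_graph_def)

text \<open>Any three distinct vertices of a larger clique would span a triangle. Triangle-freeness
  can be phrased without distinctness, since \<open>{a, c}\<close> is never an edge when
  \<open>a = c\<close>.\<close>

lemma clique_number_le_2:
  assumes "fin_simple_graph G"
    and "\<And>a b c. {a, b} \<in> edges G \<Longrightarrow> {b, c} \<in> edges G \<Longrightarrow> {a, c} \<notin> edges G"
  shows "clique_number G \<le> 2"
proof (rule clique_number_le)
  show "finite (verts G)" using assms by (auto simp: fin_simple_graph_def)
next
  fix K assume K: "clique K (edges G)"
  show "card K \<le> 2"
  proof (rule ccontr)
    assume "\<not> card K \<le> 2"
    then obtain T where "T \<subseteq> K" "card T = 3" 
      using obtain_subset_with_card_n[of 3 K] by auto
    then obtain a b c where "{a, b, c} \<subseteq> K" "a \<noteq> b" "b \<noteq> c" "a \<noteq> c"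
      by (auto simp: card_3_iff)
    with K assms(2)[of a b c] show False by (auto simp: clique_def)
  qed
qed

section \<open>Bounds on the chromatic number\<close>

lemma chromatic_number_le:
  assumes "proper_coloring G k c"
  shows "chromatic_number G \<le> k"
  unfolding chromatic_number_def using assms by (blast intro: Least_le)

text \<open>Giving all vertices different colours is proper, so some number of colours works and
  \<open>LEAST\<close> is attained.\<close>

lemma ex_proper_coloring_chromatic_number:
  assumes "fin_simple_graph G"
  shows "\<exists>c. proper_coloring G (chromatic_number G) c"
proof -
  from assms have "finite (verts G)" by (auto simp: fin_simple_graph_def)
  then obtain c where c: "bij_betw c (verts G) {0..<card (verts G)}"
    using ex_bij_betw_finite_nat by blast
  have "proper_coloring G (card (verts G)) c"
    using c fin_simple_graphD[OF assms]
    by (fastforce simp: proper_coloring_def bij_betw_def dest: inj_onD)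
  then have "\<exists>k. \<exists>c. proper_coloring G k c" by blast
  then show ?thesis unfolding chromatic_number_def
    by (rule LeastI_ex[of "\<lambda>k. \<exists>c. proper_coloring G k c"])
qed

lemma chromatic_number_ge_2:
  assumes "fin_simple_graph G" "{u, v} \<in> edges G"
  shows "2 \<le> chromatic_number G"
proof -
  obtain c where "proper_coloring G (chromatic_number G) c"
    using ex_proper_coloring_chromatic_number[OF assms(1)] by blast
  with assms(2) fin_simple_graphD[OF assms]
  have "c u < chromatic_number G" "c v < chromatic_number G" "c u \<noteq> c v"
    by (auto simp: proper_coloring_def)
  then show ?thesis by linarith
qed

lemma chromatic_number_ge_3:
  assumes "fin_simple_graph G" "{a, b} \<in> edges G" "{b, c} \<in> edges G" "{a, c} \<in> edges G"
  shows "3 \<le> chromatic_number G"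
proof -
  obtain f where "proper_coloring G (chromatic_number G) f"
    using ex_proper_coloring_chromatic_number[OF assms(1)] by blast
  with assms fin_simple_graphD[OF assms(1,2)] fin_simple_graphD[OF assms(1,3)]
  have "f a < chromatic_number G" "f b < chromatic_number G" "f c < chromatic_number G"
    "f a \<noteq> f b" "f b \<noteq> f c" "f a \<noteq> f c"
    by (auto simp: proper_coloring_def)
  then show ?thesis by linarith
qed

section \<open>Forests: triangles, leaves and 2-colourings\<close>

lemma forest_triangle_free:
  assumes "forest F" "{a, b} \<in> edges F" "{b, c} \<in> edges F"
  shows "{a, c} \<notin> edges F"
proof
  assume ac: "{a, c} \<in> edges F"
  have s: "fin_simple_graph F" using assms by (simp add: forest_def)
  have "is_cycle F [a, b, c]"
    using assms ac fin_simple_graphD[OF s assms(2)] fin_simple_graphD[OF s assms(3)]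
      fin_simple_graphD[OF s ac]
    by (auto simp: is_cycle_def less_Suc_eq insert_commute)
  with assms(1) show False by (auto simp: forest_def)
qed

text \<open>An end \<open>x\<close> of a longest path inside \<open>S\<close> works: a neighbour in
  \<open>S\<close> other than the next vertex on the path would either extend the path or close a
  cycle. Restricting to a subset \<open>S\<close> allows leaves to be removed one after another;
  isolated vertices are covered, as \<open>y\<close> is then arbitrary.\<close>

lemma forest_ex_leaf:
  assumes F: "forest F" and S: "S \<subseteq> verts F" "S \<noteq> {}"
  shows "\<exists>x\<in>S. \<exists>y. \<forall>z\<in>S. {x, z} \<in> edges F \<longrightarrow> z = y"
proof -
  define P where
    "P xs \<longleftrightarrow> xs \<noteq> [] \<and> distinct xs \<and> set xs \<subseteq> S \<and>
      (\<forall>i. Suc i < length xs \<longrightarrow> {xs ! i, xs ! Suc i} \<in> edges F)" for xs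
  have s: "fin_simple_graph F" using F by (simp add: forest_def)
  have fin: "finite S" using s S(1) by (auto simp: fin_simple_graph_def intro: finite_subset)
  obtain w where "w \<in> S" using S by blast
  then have "P [w]" by (simp add: P_def)
  \<comment> \<open>A path in \<open>S\<close> repeats no vertex, so lengths are bounded and a
    longest path exists.\<close>
  moreover have "\<forall>xs. P xs \<longrightarrow> length xs < Suc (card S)"
    by (metis P_def card_mono distinct_card fin less_Suc_eq_le)
  ultimately obtain xs where xs: "P xs" and mx: "\<And>ys. P ys \<Longrightarrow> length ys \<le> length xs"
    using ex_has_greatest_nat[of P "[w]" length "Suc (card S)"] by (auto simp: less_imp_le)
  then obtain x ys where xe: "xs = x # ys" by (cases xs) (auto simp: P_def)
  have x0: "xs ! 0 = x" using xe by simp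
  \<comment> \<open>If the path consists of \<open>x\<close> alone, \<open>ys ! 0\<close> is an
    unspecified value; the argument then shows that \<open>x\<close> has no neighbour in
    \<open>S\<close> at all.\<close>
  have "z = ys ! 0" if z: "z \<in> S" "{x, z} \<in> edges F" for z
  proof (rule ccontr)
    assume ne: "z \<noteq> ys ! 0"
    show False
    proof (cases "z \<in> set xs")
      case False
      have "P (z # xs)" unfolding P_def
      proof (intro conjI allI impI)
        fix i assume "Suc i < length (z # xs)"
        then show "{(z # xs) ! i, (z # xs) ! Suc i} \<in> edges F"
          using xs z by (cases i) (auto simp: P_def xe insert_commute)
      qed (use xs z False in \<open>auto simp: P_def\<close>)
      with mx show False by fastforce
    next
      case True
      then obtain i where i: "i < length xs" "xs ! i = z" by (auto simp: in_set_conv_nth)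
      have "i \<noteq> 0" using fin_simple_graphD(3)[OF s z(2)] i xe by (cases i) auto
      moreover have "i \<noteq> 1" using ne i xe by auto
      ultimately have i2: "2 \<le> i" by simp
      \<comment> \<open>The path from \<open>x\<close> up to \<open>z\<close>, at position
        \<open>i\<close>, is closed by the edge from \<open>z\<close> back to \<open>x\<close>;
        \<open>2 \<le> i\<close> supplies the three vertices that a cycle must have.\<close>
      have "is_cycle F (take (Suc i) xs)"
        unfolding is_cycle_def
      proof (intro conjI allI impI)
        show "3 \<le> length (take (Suc i) xs)" using i i2 by simp
        show "distinct (take (Suc i) xs)" using xs by (simp add: P_def)
        show "set (take (Suc i) xs) \<subseteq> verts F" using xs S set_take_subset[of "Suc i" xs]
          by (auto simp: P_def)
      next
        fix j assume "j < length (take (Suc i) xs)"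
        then have j: "j < Suc i" by simp
        have len: "length (take (Suc i) xs) = Suc i" using i by simp
        show "{take (Suc i) xs ! j, take (Suc i) xs ! (Suc j mod length (take (Suc i) xs))}
          \<in> edges F"
        proof (cases "j = i")
          case True
          then show ?thesis unfolding len using i(2) z(2) x0 by (simp add: insert_commute)
        next
          case False
          with j have "Suc j < Suc i" by simp
          then show ?thesis unfolding len using xs i by (simp add: P_def)
        qed
      qed
      with F show False by (auto simp: forest_def)
    qed
  qed
  moreover have "x \<in> S" using xs by (simp add: P_def xe)
  ultimately show ?thesis by blast
qed

lemma forest_2_colorable:
  assumes F: "forest F"
  obtains c where "proper_coloring F 2 c"
proof -
  have s: "fin_simple_graph F" using F by (simp add: forest_def)
  have "finite (verts F)" using s by (simp add: fin_simple_graph_def)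
  \<comment> \<open>Quantifying over vertex subsets keeps \<open>F\<close> fixed while the induction
    deletes a leaf of the part spanned by \<open>S\<close>.\<close>
  have colorable: "S \<subseteq> verts F \<Longrightarrow> \<exists>c. c ` S \<subseteq> {..<2::nat} \<and>
     (\<forall>u\<in>S. \<forall>v\<in>S. {u, v} \<in> edges F \<longrightarrow> c u \<noteq> c v)" if "finite S" for S
    using that
  proof (induction S rule: finite_psubset_induct)
    case (psubset S)
    show ?case
    proof (cases "S = {}")
      case False
      then obtain x y where xy: "x \<in> S" "\<And>z. z \<in> S \<Longrightarrow> {x, z} \<in> edges F \<Longrightarrow> z = y"
        using forest_ex_leaf[OF F psubset.prems(1)] by blast
      have "S - {x} \<subset> S" "S - {x} \<subseteq> verts F" using xy psubset.prems by auto
      then obtain c where c: "c ` (S - {x}) \<subseteq> {..<2::nat}"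
        "\<And>u v. u \<in> S - {x} \<Longrightarrow> v \<in> S - {x} \<Longrightarrow> {u, v} \<in> edges F \<Longrightarrow> c u \<noteq> c v"
        using psubset.IH[of "S - {x}"] by metis
      \<comment> \<open>The leaf gets the colour opposite to that of its only possible neighbour. If
        \<open>x\<close> has no neighbour in \<open>S\<close>, \<open>c y\<close> may be any number,
        but truncated subtraction still yields 0 or 1.\<close>
      define d where "d = c(x := 1 - c y)"
      have "d ` S \<subseteq> {..<2}" using c(1) by (auto simp: d_def)
      have dx: "d x \<noteq> d z" if "z \<in> S" "{x, z} \<in> edges F" for z
      proof -
        have zx: "z \<noteq> x" using fin_simple_graphD(3)[OF s that(2)] by simp
        moreover have "z = y" using xy that by blast
        moreover have "c z < 2" using c(1) that zx by auto
        ultimately show ?thesis by (simp add: d_def) presburger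
      qed
      have "d u \<noteq> d v" if "u \<in> S" "v \<in> S" "{u, v} \<in> edges F" for u v
        using c(2)[of u v] dx[of u] dx[of v] that
        by (cases "u = x"; cases "v = x") (auto simp: d_def insert_commute)
      with \<open>d ` S \<subseteq> {..<2}\<close> show ?thesis by blast
    qed simp
  qed
  show thesis
    using colorable[OF \<open>finite (verts F)\<close> order_refl] that
    unfolding proper_coloring_def by (elim exE)
qed

section \<open>Adding an edge to a matching, and the two cases of the theorem\<close>

lemma unfrozen_if_matching:
  assumes F: "forest F" and uv: "{u, v} \<in> edges F"
    and matching: "\<And>a b c. {a, b} \<in> edges F \<Longrightarrow> {b, c} \<in> edges F \<Longrightarrow> a = c"
  shows "unfrozen clique_number F" "unfrozen chromatic_number F"
proof -
  have s: "fin_simple_graph F" using F by (simp add: forest_def)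
  obtain c where c: "proper_coloring F 2 c" using forest_2_colorable[OF F] .
  have omega: "clique_number F = 2"
    using clique_number_ge_2[OF s uv] clique_number_le_2[OF s] forest_triangle_free[OF F]
    by (meson order_antisym)
  have chi: "chromatic_number F = 2"
    using chromatic_number_ge_2[OF s uv] chromatic_number_le[OF c] by simp
  have "clique_number (add_edge F e) = 2 \<and> chromatic_number (add_edge F e) = 2"
    if e: "e \<in> nonedges F" for e
  proof -
    have s': "fin_simple_graph (add_edge F e)" using fin_simple_graph_add_edge[OF s e] .
    have uv': "{u, v} \<in> edges (add_edge F e)" using uv by (simp add: add_edge_def)
    obtain p q where pq: "e = {p, q}" "p \<in> verts F" "q \<in> verts F" "p \<noteq> q" "{p, q} \<notin> edges F"
      using e by (auto simp: nonedges_def)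
    have tf: "{x, z} \<notin> edges (add_edge F e)"
      if "{x, y} \<in> edges (add_edge F e)" "{y, z} \<in> edges (add_edge F e)" for x y z
    proof
      assume xz: "{x, z} \<in> edges (add_edge F e)"
      note ne = fin_simple_graphD(3)[OF s' that(1)] fin_simple_graphD(3)[OF s' that(2)]
        fin_simple_graphD(3)[OF s' xz]
      \<comment> \<open>Only one of the three sides can be the new edge, so two adjacent sides are old.\<close>
      have "({x, y} \<in> edges F \<and> {y, z} \<in> edges F) \<or> ({x, y} \<in> edges F \<and> {x, z} \<in> edges F)
          \<or> ({y, z} \<in> edges F \<and> {x, z} \<in> edges F)"
        using that xz ne by (auto simp: add_edge_def doubleton_eq_iff)
      then show False using matching[of x y z] matching[of y x z] matching[of y z x] ne
        by (auto simp: insert_commute)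
    qed
    have "\<exists>d. proper_coloring (add_edge F e) 2 d"
    proof (cases "c p = c q")
      case False
      then have "proper_coloring (add_edge F e) 2 c"
        using c pq by (auto simp: proper_coloring_def add_edge_def doubleton_eq_iff)
      then show ?thesis by blast
    next
      case True
      \<comment> \<open>In a matching, \<open>p\<close> with its at most one neighbour is the whole
        component of \<open>p\<close>.\<close>
      define B where "B = {x. x = p \<or> {p, x} \<in> edges F}"
      define d where "d = (\<lambda>x. if x \<in> B then 1 - c x else c x)"
      have lt: "c x < 2" if "x \<in> verts F" for x
        using c that by (auto simp: proper_coloring_def)
      \<comment> \<open>No edge leaves \<open>B\<close>: an edge at a neighbour of \<open>p\<close>
        must lead back to \<open>p\<close>. Hence each old edge has both ends swapped or
        neither.\<close>
      have B_iff: "x \<in> B \<longleftrightarrow> y \<in> B" if "{x, y} \<in> edges F" for x y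
        using matching[of p x y] matching[of p y x] that by (auto simp: B_def insert_commute)
      have "d x \<noteq> d y" if "x \<in> verts F" "y \<in> verts F" "{x, y} \<in> edges F" for x y
      proof -
        have "c x \<noteq> c y" using c that by (auto simp: proper_coloring_def)
        then show ?thesis
          using B_iff[OF that(3)] lt[OF that(1)] lt[OF that(2)] unfolding d_def by presburger
      qed
      \<comment> \<open>As \<open>{p, q}\<close> is a nonedge of \<open>F\<close>, the swap changes
        the colour of \<open>p\<close> only, and the equal colours become different.\<close>
      moreover have "p \<in> B" "q \<notin> B" using pq by (auto simp: B_def)
      then have "d p \<noteq> d q" using True lt[OF pq(2)] unfolding d_def by presburger
      moreover have "d ` verts F \<subseteq> {..<2}" using lt by (auto simp: d_def)
      ultimately have "proper_coloring (add_edge F e) 2 d"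
        using pq by (auto simp: proper_coloring_def add_edge_def doubleton_eq_iff)
      then show ?thesis by blast
    qed
    then have "chromatic_number (add_edge F e) \<le> 2" using chromatic_number_le by blast
    then show ?thesis
      using chromatic_number_ge_2[OF s' uv'] clique_number_ge_2[OF s' uv']
        clique_number_le_2[OF s' tf] by (auto intro: order_antisym)
  qed
  then show "unfrozen clique_number F" "unfrozen chromatic_number F"
    by (simp_all add: unfrozen_def omega chi)
qed

theorem theorem9:
  fixes F :: "'a ugraph"
  assumes "forest F"
  shows "(contains_induced F (path_graph 2) \<and> \<not> contains_induced F (path_graph 3) \<longrightarrow>
            unfrozen clique_number F \<and> unfrozen chromatic_number F) \<and>
         (contains_induced F (path_graph 3) \<longrightarrow>
            \<not> unfrozen clique_number F \<and> \<not> unfrozen chromatic_number F)"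
proof (intro conjI impI; (elim conjE)?)
  have s: "fin_simple_graph F" using assms by (simp add: forest_def)
  note tf = forest_triangle_free[OF assms]
  {
    assume P2: "contains_induced F (path_graph 2)" and P3: "\<not> contains_induced F (path_graph 3)"
    obtain u v where uv: "{u, v} \<in> edges F" using contains_induced_path_2D[OF P2] .
    \<comment> \<open>Since \<open>{a, c}\<close> cannot close a triangle, distinct \<open>a\<close>
      and \<open>c\<close> would be the ends of an induced path.\<close>
    have "a = c" if "{a, b} \<in> edges F" "{b, c} \<in> edges F" for a b c
      using P3 tf[OF that] that unfolding contains_induced_path_3_iff[OF s] by blast
    then show "unfrozen clique_number F" "unfrozen chromatic_number F"
      using unfrozen_if_matching[OF assms uv] by blast+
  }
  assume "contains_induced F (path_graph 3)"
  then obtain a b c where abc: "a \<noteq> c" "{a, b} \<in> edges F" "{b, c} \<in> edges F" "{a, c} \<notin> edges F"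
    unfolding contains_induced_path_3_iff[OF s] by blast
  define G where "G = add_edge F {a, c}"
  have e: "{a, c} \<in> nonedges F"
    using abc fin_simple_graphD[OF s abc(2)] fin_simple_graphD[OF s abc(3)]
    by (auto simp: nonedges_def)
  have s': "fin_simple_graph G" unfolding G_def using fin_simple_graph_add_edge[OF s e] .
  have tri: "{a, b} \<in> edges G" "{b, c} \<in> edges G" "{a, c} \<in> edges G"
    using abc by (auto simp: G_def add_edge_def)
  \<comment> \<open>At most 2 in \<open>F\<close> against at least 3 in \<open>G\<close> separates
    the values, first for cliques and then for colours.\<close>
  have "clique_number F \<le> 2" using clique_number_le_2[OF s] tf by blast
  then show "\<not> unfrozen clique_number F"
    using clique_number_ge_3[OF s' tri] e unfolding unfrozen_def G_def by fastforce
  obtain f where "proper_coloring F 2 f" using forest_2_colorable[OF assms] .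
  then have "chromatic_number F \<le> 2" by (rule chromatic_number_le)
  then show "\<not> unfrozen chromatic_number F"
    using chromatic_number_ge_3[OF s' tri] e unfolding unfrozen_def G_def by fastforce
qed

end
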